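(* Let $k \geqslant 2$ be a fixed integer. There exists $n_0 = n_0(k)$ such that for every integer $n \geqslant n_0$ and every positive integer $q$ the following hold for the $(1:q)$ Client--Waiter $k$--SAT game played on the set $\mathcal{C}^{(k)}_n$ of all $k$--clauses over $n$ boolean variables. (i) If $q < \binom{n}{k}/n$, then Client has a strategy ensuring that the conjunction of all $k$--clauses he claims by the end of the game is not satisfiable. (ii) If $q \geqslant 16k^3\binom{n}{k}/n$, then Waiter has a strategy ensuring that the conjunction of all $k$--clauses claimed by Client is satisfiable throughout the game.
   Context: Fix boolean variables $x_1,\ldots,x_n$. A literal is a variable $x_i$ or its negation $\neg x_i$. A $k$--clause is the disjunction of exactly $k$ non--complementary literals, i.e. of $k$ literals belonging to $k$ distinct variables (clauses are identified with their sets of literals). $\mathcal{C}^{(k)}_n$ denotes the set of all $2^k\binom{n}{k}$ possible $k$--clauses over $x_1,\ldots,x_n$. A conjunction of $k$--clauses is satisfiable if some $\{0,1\}$--assignment to the variables makes every clause true. The $(1:q)$ Client--Waiter game $(X,\mathcal{F})$, where $X$ is a finite set (the board), $\mathcal{F}$ is the family of winning sets (subsets of $X$) and $q$ is a positive integer, is the following two--player perfect information game. At the beginning of each round, Waiter offers Client $t$ free (that is, previously unclaimed) elements of $X$, where Waiter chooses both the elements and the number $t$ with $1\leqslant t\leqslant q+1$. Client claims one of these, and the remaining offered elements (if any) are claimed by Waiter. The game ends when all elements of $X$ are claimed. Client wins if he has fully claimed some winning set in $\mathcal{F}$; otherwise Waiter wins. The $k$--SAT game has board $X=\mathcal{C}^{(k)}_n$,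 and its winning sets are the sets $\mathcal{S}\subseteq\mathcal{C}^{(k)}_n$ whose conjunction $\bigwedge\mathcal{S}$ is not satisfiable. *)

theory Defs
  imports Complex_Main
begin

section \<open>Client--Waiter games\<close>

text \<open>The record of a game lists its rounds in order. A round is a pair of the set offered by
  Waiter and the element of it claimed by Client; Waiter claims the rest of the offer.\<close>

type_synonym 'a history = "('a set \<times> 'a) list"

definition claimed :: "'a history \<Rightarrow> 'a set" where
  "claimed h = (\<Union>(A, x)\<in>set h. A)"

definition client_claims :: "'a history \<Rightarrow> 'a set" where
  "client_claims h = snd ` set h"

definition legal_offer :: "'a set \<Rightarrow> nat \<Rightarrow> 'a history \<Rightarrow> 'a set \<Rightarrow> bool" where
  "legal_offer X q h A \<longleftrightarrow> A \<subseteq> X - claimed h \<and> 1 \<le> card A \<and> card A \<le> q + 1"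

text \<open>Legal records, possibly of a game that is not yet finished.\<close>

inductive play :: "'a set \<Rightarrow> nat \<Rightarrow> 'a history \<Rightarrow> bool" for X :: "'a set" and q :: nat where
  play_start: "play X q []"
| play_round: "\<lbrakk>play X q h; legal_offer X q h A; x \<in> A\<rbrakk> \<Longrightarrow> play X q (h @ [(A, x)])"

definition finished :: "'a set \<Rightarrow> 'a history \<Rightarrow> bool" where
  "finished X h \<longleftrightarrow> claimed h = X"

definition client_strategy :: "'a set \<Rightarrow> nat \<Rightarrow> ('a history \<Rightarrow> 'a set \<Rightarrow> 'a) \<Rightarrow> bool" where
  "client_strategy X q \<sigma> \<longleftrightarrow> (\<forall>h A. play X q h \<and> legal_offer X q h A \<longrightarrow> \<sigma> h A \<in> A)"

definition waiter_strategy :: "'a set \<Rightarrow> nat \<Rightarrow> ('a history \<Rightarrow> 'a set) \<Rightarrow> bool" where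
  "waiter_strategy X q \<tau> \<longleftrightarrow>
     (\<forall>h. play X q h \<and> \<not> finished X h \<longrightarrow> legal_offer X q h (\<tau> h))"

definition follows_client :: "('a history \<Rightarrow> 'a set \<Rightarrow> 'a) \<Rightarrow> 'a history \<Rightarrow> bool" where
  "follows_client \<sigma> h \<longleftrightarrow> (\<forall>i<length h. snd (h ! i) = \<sigma> (take i h) (fst (h ! i)))"

definition follows_waiter :: "('a history \<Rightarrow> 'a set) \<Rightarrow> 'a history \<Rightarrow> bool" where
  "follows_waiter \<tau> h \<longleftrightarrow> (\<forall>i<length h. fst (h ! i) = \<tau> (take i h))"

text \<open>Client can force the set of all elements he claims by the end of the game to satisfy
  \<open>P\<close>.\<close>

definition client_can_ensure_at_end :: "'a set \<Rightarrow> nat \<Rightarrow> ('a set \<Rightarrow> bool) \<Rightarrow> bool" where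
  "client_can_ensure_at_end X q P \<longleftrightarrow>
     (\<exists>\<sigma>. client_strategy X q \<sigma> \<and>
       (\<forall>h. play X q h \<and> follows_client \<sigma> h \<and> finished X h \<longrightarrow> P (client_claims h)))"

text \<open>Waiter can force the set of Client's elements to satisfy \<open>P\<close> after every round, so \<open>h\<close>
  ranges over unfinished games too.\<close>

definition waiter_can_ensure_throughout :: "'a set \<Rightarrow> nat \<Rightarrow> ('a set \<Rightarrow> bool) \<Rightarrow> bool" where
  "waiter_can_ensure_throughout X q P \<longleftrightarrow>
     (\<exists>\<tau>. waiter_strategy X q \<tau> \<and>
       (\<forall>h. play X q h \<and> follows_waiter \<tau> h \<longrightarrow> P (client_claims h)))"

section \<open>Clauses\<close>

datatype literal = Pos (var: nat) | Neg (var: nat)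

primrec literal_true :: "(nat \<Rightarrow> bool) \<Rightarrow> literal \<Rightarrow> bool" where
  "literal_true a (Pos i) = a i"
| "literal_true a (Neg i) = (\<not> a i)"

text \<open>Injectivity of \<^const>\<open>var\<close> says that the literals belong to distinct variables.\<close>

definition clauses :: "nat \<Rightarrow> nat \<Rightarrow> literal set set" where
  "clauses k n = {C. var ` C \<subseteq> {1..n} \<and> card C = k \<and> inj_on var C}"

text \<open>A set of clauses stands for their conjunction.\<close>

definition satisfiable :: "literal set set \<Rightarrow> bool" where
  "satisfiable S \<longleftrightarrow> (\<exists>a. \<forall>C\<in>S. \<exists>l\<in>C. literal_true a l)"

definition ksat_winning_sets :: "nat \<Rightarrow> nat \<Rightarrow> literal set set set" where
  "ksat_winning_sets k n = {S. S \<subseteq> clauses k n \<and> \<not> satisfiable S}"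

text \<open>Claiming a winning set in full amounts to claiming an unsatisfiable set of clauses.\<close>

lemma claims_ksat_winning_set_iff:
  assumes "S \<subseteq> clauses k n"
  shows "(\<exists>F\<in>ksat_winning_sets k n. F \<subseteq> S) \<longleftrightarrow> \<not> satisfiable S"
  using assms unfolding ksat_winning_sets_def satisfiable_def by blast

end

theory Submission
  imports Defs
begin

text \<open>
  (i) Every assignment violates exactly \<open>n choose k\<close> clauses. Give an assignment that satisfies all
  of Client's clauses the weight \<open>exp (- f / (q + 1))\<close>, where \<open>f\<close> is the number of free clauses it
  violates. If Client picks uniformly from the offer, the expected total weight does not increase,
  so some choice does not increase it. At the end the total weight is the number of satisfying
  assignments, and at the start it is \<open>2 ^ n * exp (- (n choose k) / (q + 1)) < 1\<close>.

  (ii) Waiter fixes the values of the variables \<open>1, \<dots>, n\<close> one after the other. Before fixing the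
  variable \<open>v\<close> he offers, all at once, the clauses with largest variable \<open>v\<close> that the earlier values
  do not satisfy. For each set of variables only the two signs of \<open>v\<close> are left, hence there are at
  most \<open>2 * ((n - 1) choose (k - 1))\<close> of these, and Client's single choice can be satisfied by the
  value of \<open>v\<close>. All other clauses are satisfied anyway.
\<close>

section \<open>Strategies from invariants of positions\<close>

lemma claimed_Nil [simp]: "claimed [] = {}"
  by (simp add: claimed_def)

lemma claimed_snoc [simp]: "claimed (h @ [(A, x)]) = claimed h \<union> A"
  by (auto simp: claimed_def)

lemma client_claims_Nil [simp]: "client_claims [] = {}"
  by (simp add: client_claims_def)

lemma client_claims_snoc [simp]: "client_claims (h @ [(A, x)]) = insert x (client_claims h)"
  by (simp add: client_claims_def)

lemma follows_client_snoc [simp]: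
  "follows_client \<sigma> (h @ [(A, x)]) \<longleftrightarrow> follows_client \<sigma> h \<and> x = \<sigma> h A"
  by (auto simp: follows_client_def nth_append less_Suc_eq)

lemma follows_waiter_snoc [simp]:
  "follows_waiter \<tau> (h @ [(A, x)]) \<longleftrightarrow> follows_waiter \<tau> h \<and> A = \<tau> h"
  by (auto simp: follows_waiter_def nth_append less_Suc_eq)

lemma play_claimed_subset: "play X q h \<Longrightarrow> claimed h \<subseteq> X"
  by (induction rule: play.induct) (auto simp: legal_offer_def)

lemma legal_offerD:
  assumes "legal_offer X q h A"
  shows "A \<subseteq> X - claimed h" "A \<noteq> {}" "finite A" "card A \<le> q + 1"
proof -
  from assms show "A \<subseteq> X - claimed h" "card A \<le> q + 1"
    by (simp_all add: legal_offer_def)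
  from assms have "card A \<noteq> 0"
    by (simp add: legal_offer_def)
  then show "A \<noteq> {}" "finite A"
    by (auto intro: card_ge_0_finite)
qed

text \<open>Reduces a strategy on records to a one-round statement about positions: \<open>F\<close>
  stands for the free elements, \<open>S\<close> for Client's. The choice operator picks the
  moves.\<close>

lemma client_can_ensure_at_endI:
  assumes init: "Inv X {}"
    and step: "\<And>F S A. \<lbrakk>Inv F S; A \<subseteq> F; A \<noteq> {}; finite A; card A \<le> q + 1\<rbrakk>
      \<Longrightarrow> \<exists>x\<in>A. Inv (F - A) (insert x S)"
    and final: "\<And>S. Inv {} S \<Longrightarrow> P S"
  shows "client_can_ensure_at_end X q P"
proof -
  define \<sigma> where "\<sigma> h A = (SOME x. x \<in> A \<and>
    (Inv (X - claimed h) (client_claims h) \<longrightarrow>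
      Inv (X - claimed h - A) (insert x (client_claims h))))" for h :: "'a history" and A
  have \<sigma>: "\<sigma> h A \<in> A \<and> (Inv (X - claimed h) (client_claims h) \<longrightarrow>
      Inv (X - claimed h - A) (insert (\<sigma> h A) (client_claims h)))"
    if "legal_offer X q h A" for h A
    unfolding \<sigma>_def
  proof (rule someI_ex, cases "Inv (X - claimed h) (client_claims h)")
    case True
    from step[OF True legal_offerD[OF that]]
    show "\<exists>x. x \<in> A \<and> (Inv (X - claimed h) (client_claims h) \<longrightarrow>
      Inv (X - claimed h - A) (insert x (client_claims h)))" by blast
  next
    case False
    with legal_offerD(2)[OF that]
    show "\<exists>x. x \<in> A \<and> (Inv (X - claimed h) (client_claims h) \<longrightarrow>
      Inv (X - claimed h - A) (insert x (client_claims h)))" by blast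
  qed
  have inv: "follows_client \<sigma> h \<Longrightarrow> Inv (X - claimed h) (client_claims h)" if "play X q h" for h
    using that
  proof (induction rule: play.induct)
    case play_start
    show ?case using init by simp
  next
    case (play_round h A x)
    moreover have "X - (claimed h \<union> A) = X - claimed h - A" by blast
    ultimately show ?case using \<sigma>[of h A] by simp
  qed
  show ?thesis
    unfolding client_can_ensure_at_end_def
  proof (intro exI conjI allI impI)
    show "client_strategy X q \<sigma>"
      using \<sigma> by (auto simp: client_strategy_def)
    show "P (client_claims h)" if "play X q h \<and> follows_client \<sigma> h \<and> finished X h" for h
      using inv[of h] final that by (simp add: finished_def)
  qed
qed

lemma waiter_can_ensure_throughoutI:
  assumes init: "Inv X {}"
    and step: "\<And>F S. \<lbrakk>Inv F S; F \<noteq> {}\<rbrakk>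
      \<Longrightarrow> \<exists>A\<subseteq>F. A \<noteq> {} \<and> finite A \<and> card A \<le> q + 1 \<and> (\<forall>x\<in>A. Inv (F - A) (insert x S))"
    and safe: "\<And>F S. Inv F S \<Longrightarrow> P S"
    and "finite X"
  shows "waiter_can_ensure_throughout X q P"
proof -
  define good where "good h A \<longleftrightarrow> legal_offer X q h A \<and>
    (Inv (X - claimed h) (client_claims h) \<longrightarrow>
      (\<forall>x\<in>A. Inv (X - claimed h - A) (insert x (client_claims h))))" for h A
  define \<tau> where "\<tau> h = (SOME A. good h A)" for h
  have \<tau>: "good h (\<tau> h)" if "play X q h" "\<not> finished X h" for h
    unfolding \<tau>_def
  proof (rule someI_ex)
    have ne: "X - claimed h \<noteq> {}"
      using play_claimed_subset[OF that(1)] that(2) by (auto simp: finished_def)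
    show "\<exists>A. good h A"
    proof (cases "Inv (X - claimed h) (client_claims h)")
      case True
      from step[OF this ne] show ?thesis
        by (auto simp: good_def legal_offer_def Suc_le_eq card_gt_0_iff)
    next
      case False
      \<comment> \<open>Off the invariant, a single free element is a legal offer for every
        bias.\<close>
      from ne obtain x where "x \<in> X - claimed h" by blast
      with False show ?thesis
        by (intro exI[of _ "{x}"]) (auto simp: good_def legal_offer_def)
    qed
  qed
  have inv: "follows_waiter \<tau> h \<Longrightarrow> Inv (X - claimed h) (client_claims h)" if "play X q h" for h
    using that
  proof (induction rule: play.induct)
    case play_start
    show ?case using init by simp
  next
    case (play_round h A x)
    then have "\<not> finished X h"
      by (auto simp: finished_def legal_offer_def)
    moreover have "X - (claimed h \<union> A) = X - claimed h - A" by blast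
    ultimately show ?case
      using play_round \<tau>[of h] by (simp add: good_def)
  qed
  show ?thesis
    unfolding waiter_can_ensure_throughout_def
  proof (intro exI conjI allI impI)
    show "waiter_strategy X q \<tau>"
      using \<tau> by (auto simp: waiter_strategy_def good_def)
    show "P (client_claims h)" if "play X q h \<and> follows_waiter \<tau> h" for h
      using inv safe that by blast
  qed
qed

section \<open>Clauses violated by an assignment\<close>

definition false_literal :: "(nat \<Rightarrow> bool) \<Rightarrow> nat \<Rightarrow> literal" where
  "false_literal a i = (if a i then Neg i else Pos i)"

lemma var_false_literal [simp]: "var (false_literal a i) = i"
  by (simp add: false_literal_def)

lemma inj_false_literal: "inj_on (false_literal a) A"
  by (rule inj_on_inverseI[of _ var]) simp

lemma not_literal_true_iff: "\<not> literal_true a l \<longleftrightarrow> l = false_literal a (var l)"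
  by (cases l) (auto simp: false_literal_def)

lemma literal_true_cong: "a (var l) = b (var l) \<Longrightarrow> literal_true a l = literal_true b l"
  by (cases l) auto

definition violated :: "nat \<Rightarrow> nat \<Rightarrow> (nat \<Rightarrow> bool) \<Rightarrow> literal set set" where
  "violated k n a = {C \<in> clauses k n. \<forall>l\<in>C. \<not> literal_true a l}"

lemma all_false_eq_image:
  assumes "\<forall>l\<in>C. \<not> literal_true a l"
  shows "C = false_literal a ` var ` C"
  using assms by (force simp: not_literal_true_iff)

lemma violated_eq_image:
  "violated k n a = (`) (false_literal a) ` {U. U \<subseteq> {1..n} \<and> card U = k}"
proof (intro equalityI subsetI)
  fix C assume C: "C \<in> violated k n a"
  then have "C = false_literal a ` var ` C"
    by (intro all_false_eq_image) (simp add: violated_def)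
  moreover have "var ` C \<subseteq> {1..n}" "card (var ` C) = k"
    using C by (auto simp: violated_def clauses_def card_image)
  ultimately show "C \<in> (`) (false_literal a) ` {U. U \<subseteq> {1..n} \<and> card U = k}"
    by blast
next
  fix C assume "C \<in> (`) (false_literal a) ` {U. U \<subseteq> {1..n} \<and> card U = k}"
  then obtain U where "U \<subseteq> {1..n}" "card U = k" "C = false_literal a ` U"
    by blast
  then show "C \<in> violated k n a"
    by (auto simp: violated_def clauses_def image_image card_image inj_false_literal
        not_literal_true_iff intro!: inj_onI)
qed

text \<open>A violated clause is determined by its set of variables, which can be any
  \<open>k\<close>-subset. The count does not depend on \<open>a\<close>, so all assignments start
  with the same weight.\<close>

lemma card_violated: "card (violated k n a) = n choose k"
proof -
  have "inj_on ((`) (false_literal a)) A" for A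
    by (rule inj_on_inverseI[of _ "(`) var"]) (simp add: image_image)
  then show ?thesis
    by (simp add: violated_eq_image card_image n_subsets)
qed

lemma finite_clauses: "finite (clauses k n)"
proof (rule finite_subset)
  show "clauses k n \<subseteq> Pow (Pos ` {1..n} \<union> Neg ` {1..n})"
  proof
    fix C assume C: "C \<in> clauses k n"
    have "l \<in> Pos ` {1..n} \<union> Neg ` {1..n}" if "l \<in> C" for l
      using C that by (cases l) (force simp: clauses_def)+
    then show "C \<in> Pow (Pos ` {1..n} \<union> Neg ` {1..n})" by blast
  qed
qed simp

section \<open>Client's strategy\<close>

text \<open>The danger that Client never claims an element of the target \<open>V\<close>: it
  vanishes once \<open>V\<close> is hit and grows as free elements of \<open>V\<close>
  disappear.\<close>

definition weight :: "nat \<Rightarrow> 'a set \<Rightarrow> 'a set \<Rightarrow> 'a set \<Rightarrow> real" where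
  "weight q V F S = (if V \<inter> S = {} then exp (- real (card (V \<inter> F)) / (real q + 1)) else 0)"

lemma weight_nonneg: "weight q V F S \<ge> 0"
  by (simp add: weight_def)

text \<open>After division by \<open>card A\<close> this bounds the mean over a uniform choice from
  the offer. If \<open>r\<close> of \<open>t\<close> offered elements lie in \<open>V\<close>, then
  \<open>V\<close> stays unhit with probability \<open>1 - r / t\<close>, while its weight grows by
  \<open>exp (r / (q + 1))\<close>; the product is at most 1.\<close>

lemma sum_weight_le:
  assumes "finite F" "A \<subseteq> F" "A \<noteq> {}" "card A \<le> q + 1"
  shows "(\<Sum>x\<in>A. weight q V (F - A) (insert x S)) \<le> real (card A) * weight q V F S"
proof (cases "V \<inter> S = {}")
  case False
  then have "weight q V (F - A) (insert x S) = 0" for x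
    by (auto simp: weight_def)
  with False show ?thesis by (simp add: weight_def)
next
  case True
  have fin: "finite A" using assms finite_subset by blast
  define t r f where "t = card A" and "r = card (V \<inter> A)" and "f = card (V \<inter> (F - A))"
  define w where "w = exp (- real f / (real q + 1))"
  have t: "t > 0" "real t \<le> real q + 1"
    using assms fin by (simp_all add: t_def card_gt_0_iff)
  have rt: "r \<le> t"
    unfolding r_def t_def by (intro card_mono fin) auto
  have "(\<Sum>x\<in>A. weight q V (F - A) (insert x S)) = (\<Sum>x\<in>A. if x \<in> V then 0 else w)"
    using True by (intro sum.cong) (auto simp: weight_def w_def f_def)
  also have "\<dots> = real (card (A - V)) * w"
    using fin by (simp add: sum.If_cases Diff_eq)
  also have "card (A - V) = t - r"
    using fin by (simp add: t_def r_def card_Diff_subset_Int Int_commute)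
  also have "real (t - r) * w \<le> real t * (w * exp (- real r / (real q + 1)))"
  proof -
    have "real (t - r) = real t * (1 + - real r / real t)"
      using t rt by (simp add: field_simps of_nat_diff)
    also have "\<dots> \<le> real t * exp (- real r / real t)"
      using t by (intro mult_left_mono exp_ge_add_one_self) auto
    \<comment> \<open>The bias enters here, through \<open>t \<le> q + 1\<close>.\<close>
    also have "\<dots> \<le> real t * exp (- real r / (real q + 1))"
      using t by (intro mult_left_mono) (auto intro: divide_left_mono)
    finally have "real (t - r) * w \<le> real t * exp (- real r / (real q + 1)) * w"
      by (intro mult_right_mono) (simp_all add: w_def)
    then show ?thesis by (simp add: mult_ac)
  qed
  also have "w * exp (- real r / (real q + 1)) = weight q V F S"
  proof -
    have "V \<inter> F = (V \<inter> (F - A)) \<union> (V \<inter> A)" "(V \<inter> (F - A)) \<inter> (V \<inter> A) = {}"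
      using assms by auto
    then have "card (V \<inter> F) = f + r"
      using assms fin by (simp add: f_def r_def card_Un_disjoint)
    then show ?thesis
      using True by (simp add: weight_def w_def diff_divide_distrib add_divide_distrib
          flip: exp_add)
  qed
  finally show ?thesis by (simp add: t_def)
qed

lemma client_can_hit_all:
  fixes V :: "'i \<Rightarrow> 'a set"
  assumes "finite X" "finite I"
    and V: "\<And>i. i \<in> I \<Longrightarrow> V i \<subseteq> X" "\<And>i. i \<in> I \<Longrightarrow> card (V i) = m"
    and less: "real (card I) * exp (- real m / (real q + 1)) < 1"
  shows "client_can_ensure_at_end X q (\<lambda>S. \<forall>i\<in>I. V i \<inter> S \<noteq> {})"
proof (rule client_can_ensure_at_endI
    [where Inv = "\<lambda>F S. finite F \<and> (\<Sum>i\<in>I. weight q (V i) F S) < 1"])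
  have "(\<Sum>i\<in>I. weight q (V i) X {}) = (\<Sum>i\<in>I. exp (- real m / (real q + 1)))"
    using V by (intro sum.cong) (auto simp: weight_def Int_absorb2)
  then show "finite X \<and> (\<Sum>i\<in>I. weight q (V i) X {}) < 1"
    using less \<open>finite X\<close> by simp
next
  fix F S A
  assume inv: "finite F \<and> (\<Sum>i\<in>I. weight q (V i) F S) < 1"
    and A: "A \<subseteq> F" "A \<noteq> {}" "finite A" "card A \<le> q + 1"
  \<comment> \<open>Averaging: if every choice increased the total, so would the sum over all
    choices, against \<open>sum_weight_le\<close> applied to each target.\<close>
  have "\<exists>x\<in>A. (\<Sum>i\<in>I. weight q (V i) (F - A) (insert x S)) \<le> (\<Sum>i\<in>I. weight q (V i) F S)"
  proof (rule ccontr)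
    assume "\<not> ?thesis"
    then have "(\<Sum>x\<in>A. \<Sum>i\<in>I. weight q (V i) F S)
        < (\<Sum>x\<in>A. \<Sum>i\<in>I. weight q (V i) (F - A) (insert x S))"
      by (intro sum_strict_mono[OF A(3,2)]) (simp add: not_le)
    also have "\<dots> = (\<Sum>i\<in>I. \<Sum>x\<in>A. weight q (V i) (F - A) (insert x S))"
      by (rule sum.swap)
    also have "\<dots> \<le> (\<Sum>i\<in>I. real (card A) * weight q (V i) F S)"
      using inv A by (intro sum_mono sum_weight_le) auto
    finally show False by (simp add: sum_distrib_left)
  qed
  with inv show "\<exists>x\<in>A. finite (F - A) \<and> (\<Sum>i\<in>I. weight q (V i) (F - A) (insert x S)) < 1"
    by force
next
  fix S
  assume inv: "finite ({} :: 'a set) \<and> (\<Sum>i\<in>I. weight q (V i) {} S) < 1"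
  show "\<forall>i\<in>I. V i \<inter> S \<noteq> {}"
  proof (intro ballI notI)
    fix i assume "i \<in> I" "V i \<inter> S = {}"
    \<comment> \<open>With no free elements left, an unhit target has weight \<open>exp 0\<close>,
      so one such target already pushes the total to 1.\<close>
    then have "1 = weight q (V i) {} S" by (simp add: weight_def)
    also have "\<dots> \<le> (\<Sum>i\<in>I. weight q (V i) {} S)"
      using \<open>i \<in> I\<close> \<open>finite I\<close> by (intro member_le_sum weight_nonneg) auto
    finally show False using inv by simp
  qed
qed

lemma client_can_ensure_at_end_mono:
  assumes "client_can_ensure_at_end X q P" "\<And>S. P S \<Longrightarrow> Q S"
  shows "client_can_ensure_at_end X q Q"
  using assms unfolding client_can_ensure_at_end_def by blast

text \<open>Assignments are functions on all naturals, but a clause sees only their values on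
  \<open>{1..n}\<close>. Hence the \<open>2 ^ n\<close> subsets \<open>Z\<close> represent all of
  them.\<close>

lemma not_satisfiableI:
  assumes "\<And>Z. Z \<subseteq> {1..n} \<Longrightarrow> violated k n (\<lambda>i. i \<in> Z) \<inter> S \<noteq> {}"
  shows "\<not> satisfiable S"
proof
  assume "satisfiable S"
  then obtain a where a: "\<forall>C\<in>S. \<exists>l\<in>C. literal_true a l"
    by (auto simp: satisfiable_def)
  define Z where "Z = {i \<in> {1..n}. a i}"
  have "Z \<subseteq> {1..n}" by (auto simp: Z_def)
  from assms[OF this] obtain C
    where C: "C \<in> clauses k n" "C \<in> S" "\<forall>l\<in>C. \<not> literal_true (\<lambda>i. i \<in> Z) l"
    unfolding violated_def by blast
  from a C(2) obtain l where l: "l \<in> C" "literal_true a l" by blast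
  with C(1) have "var l \<in> {1..n}" by (auto simp: clauses_def)
  then have "literal_true (\<lambda>i. i \<in> Z) l = literal_true a l"
    by (intro literal_true_cong) (simp add: Z_def)
  with l C(3) show False by blast
qed

lemma client_wins_ksat:
  assumes "2 ^ n * exp (- real (n choose k) / (real q + 1)) < 1"
  shows "client_can_ensure_at_end (clauses k n) q (\<lambda>S. \<not> satisfiable S)"
proof (rule client_can_ensure_at_end_mono)
  show "client_can_ensure_at_end (clauses k n) q
      (\<lambda>S. \<forall>Z\<in>Pow {1..n}. violated k n (\<lambda>i. i \<in> Z) \<inter> S \<noteq> {})"
    using assms
    by (intro client_can_hit_all[where m = "n choose k"] finite_clauses)
      (auto simp: card_violated card_Pow, auto simp: violated_def)
next
  fix S
  assume "\<forall>Z\<in>Pow {1..n}. violated k n (\<lambda>i. i \<in> Z) \<inter> S \<noteq> {}"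
  then show "\<not> satisfiable S"
    by (intro not_satisfiableI[of n k]) blast
qed

section \<open>Waiter's strategy\<close>

text \<open>The position after the values \<open>a\<close> of the variables up to \<open>v\<close> have been fixed.\<close>

definition waiter_inv ::
    "nat \<Rightarrow> nat \<Rightarrow> nat \<Rightarrow> (nat \<Rightarrow> bool) \<Rightarrow> literal set set \<Rightarrow> literal set set \<Rightarrow> bool" where
  "waiter_inv k n v a F S \<longleftrightarrow> v \<le> n \<and> F \<subseteq> clauses k n \<and>
     (\<forall>C\<in>F. var ` C \<subseteq> {1..v} \<longrightarrow> (\<exists>l\<in>C. literal_true a l)) \<and>
     (\<forall>C\<in>S. \<exists>l\<in>C. var l \<le> v \<and> literal_true a l)"

text \<open>Waiter's next offer. That \<open>Suc v\<close> occurs in these clauses is not demanded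
  here; it follows from the invariant.\<close>

definition pending :: "nat \<Rightarrow> (nat \<Rightarrow> bool) \<Rightarrow> literal set set \<Rightarrow> literal set set" where
  "pending v a F =
     {C \<in> F. var ` C \<subseteq> {1..Suc v} \<and> (\<forall>l\<in>C. var l \<le> v \<longrightarrow> \<not> literal_true a l)}"

text \<open>Otherwise the clause would use only fixed variables and be false, but the invariant
  makes such free clauses true.\<close>

lemma waiter_inv_pending:
  assumes "waiter_inv k n v a F S" "C \<in> pending v a F"
  shows "\<exists>l\<in>C. var l = Suc v"
proof (rule ccontr)
  assume no: "\<not> ?thesis"
  have "var ` C \<subseteq> {1..v}"
  proof
    fix i assume "i \<in> var ` C"
    then show "i \<in> {1..v}"
      using assms(2) no by (fastforce simp: pending_def le_Suc_eq)
  qed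
  with assms show False
    by (fastforce simp: waiter_inv_def pending_def)
qed

text \<open>All literals on earlier variables are false under \<open>a\<close>, so the other
  \<open>k - 1\<close> variables and the sign of \<open>Suc v\<close> determine the clause.\<close>

lemma card_pending:
  assumes "waiter_inv k n v a F S" "v < n"
  shows "card (pending v a F) \<le> 2 * ((n - 1) choose (k - 1))"
proof -
  let ?D = "{U. U \<subseteq> {1..v} \<and> card U = k - 1} \<times> {Pos (Suc v), Neg (Suc v)}"
  let ?f = "\<lambda>(U, l). insert l (false_literal a ` U)"
  have fin: "finite ?D" by simp
  have "pending v a F \<subseteq> ?f ` ?D"
  proof
    fix C assume C: "C \<in> pending v a F"
    from waiter_inv_pending[OF assms(1) C] obtain l where l: "l \<in> C" "var l = Suc v" by blast
    have cl: "card C = k" "inj_on var C"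
      using C assms(1) by (auto simp: pending_def waiter_inv_def clauses_def)
    have le: "var l' \<in> {1..v}" if "l' \<in> C - {l}" for l'
    proof -
      have "var l' \<in> {1..Suc v}" using C that by (auto simp: pending_def)
      moreover have "var l' \<noteq> var l" using that l(1) inj_on_eq_iff[OF cl(2)] by blast
      ultimately show ?thesis using l by auto
    qed
    have "C - {l} = false_literal a ` var ` (C - {l})"
      using C le by (intro all_false_eq_image) (auto simp: pending_def)
    moreover have "card (var ` (C - {l})) = k - 1"
      using cl l by (simp add: card_image inj_on_diff)
    moreover have "l \<in> {Pos (Suc v), Neg (Suc v)}"
      using l by (cases l) auto
    ultimately have "C = ?f (var ` (C - {l}), l)" "(var ` (C - {l}), l) \<in> ?D"
      using l le by auto
    then show "C \<in> ?f ` ?D" by blast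
  qed
  then have "card (pending v a F) \<le> card ?D"
    using fin by (rule surj_card_le[rotated])
  also have "\<dots> = 2 * (v choose (k - 1))"
    by (simp add: card_cartesian_product n_subsets)
  also have "\<dots> \<le> 2 * ((n - 1) choose (k - 1))"
    using assms(2) by (intro mult_left_mono binomial_right_mono) auto
  finally show ?thesis .
qed

text \<open>With nothing to offer, the value that \<open>a\<close> happens to give to
  \<open>Suc v\<close> is kept and no round is played.\<close>

lemma waiter_inv_advance:
  assumes "waiter_inv k n v a F S" "v < n" "pending v a F = {}"
  shows "waiter_inv k n (Suc v) a F S"
proof -
  have "\<exists>l\<in>C. literal_true a l" if "C \<in> F" "var ` C \<subseteq> {1..Suc v}" for C
    using assms(3) that unfolding pending_def by blast
  moreover have "\<exists>l\<in>C. var l \<le> Suc v \<and> literal_true a l" if "C \<in> S" for C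
    using assms(1) that unfolding waiter_inv_def by (meson le_SucI)
  ultimately show ?thesis
    using assms(1,2) by (simp add: waiter_inv_def)
qed

text \<open>Resetting \<open>Suc v\<close> preserves literals on earlier variables. These satisfy
  Client's old clauses, and also each remaining free clause on the variables up to
  \<open>Suc v\<close>, as it was not pending.\<close>

lemma waiter_inv_claim:
  assumes inv: "waiter_inv k n v a F S" and "v < n" and C: "C \<in> pending v a F"
  shows "\<exists>b. waiter_inv k n (Suc v) b (F - pending v a F) (insert C S)"
proof -
  from waiter_inv_pending[OF inv C] obtain l where l: "l \<in> C" "var l = Suc v" by blast
  define b where "b = a(Suc v := (l = Pos (Suc v)))"
  have b: "literal_true b l' = literal_true a l'" if "var l' \<le> v" for l'
    using that by (intro literal_true_cong) (simp add: b_def)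
  have "literal_true b l"
    using l by (cases l) (auto simp: b_def)
  with l have "\<exists>l\<in>C. var l \<le> Suc v \<and> literal_true b l"
    by (intro bexI[of _ l]) simp_all
  moreover have "\<exists>l\<in>D. var l \<le> Suc v \<and> literal_true b l" if "D \<in> S" for D
    using inv that b unfolding waiter_inv_def by (meson le_SucI)
  moreover have "\<exists>l\<in>D. literal_true b l"
    if "D \<in> F - pending v a F" "var ` D \<subseteq> {1..Suc v}" for D
    using that b unfolding pending_def by blast
  ultimately have "waiter_inv k n (Suc v) b (F - pending v a F) (insert C S)"
    using inv \<open>v < n\<close> by (auto simp: waiter_inv_def)
  then show ?thesis by (rule exI[of _ b])
qed

lemma waiter_inv_step:
  assumes "waiter_inv k n v a F S" "F \<noteq> {}" "2 * ((n - 1) choose (k - 1)) \<le> q + 1"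
  shows "\<exists>A\<subseteq>F. A \<noteq> {} \<and> finite A \<and> card A \<le> q + 1 \<and>
    (\<forall>C\<in>A. \<exists>w b. waiter_inv k n w b (F - A) (insert C S))"
  using assms(1)
\<comment> \<open>Several variables may be passed before one has pending clauses, hence the
  induction on the number of unfixed variables.\<close>
proof (induction "n - v" arbitrary: v)
  case 0
  then have v: "v = n" by (simp add: waiter_inv_def)
  \<comment> \<open>All variables are fixed and every free clause is true, so clauses can be offered
    one at a time.\<close>
  from \<open>F \<noteq> {}\<close> obtain C where C: "C \<in> F" by blast
  then have "var ` C \<subseteq> {1..n}"
    using 0 by (auto simp: waiter_inv_def clauses_def)
  then have "\<exists>l\<in>C. var l \<le> n \<and> literal_true a l"
    using 0 C v by (fastforce simp: waiter_inv_def)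
  then have "waiter_inv k n v a (F - {C}) (insert C S)"
    using 0 v by (auto simp: waiter_inv_def)
  with C show ?case
    by (intro exI[of _ "{C}"]) auto
next
  case (Suc m)
  then have "v < n" by simp
  show ?case
  proof (cases "pending v a F = {}")
    case True
    show ?thesis
      by (rule Suc.hyps(1)[OF _ waiter_inv_advance[OF Suc.prems \<open>v < n\<close> True]])
        (use Suc.hyps(2) in simp)
  next
    case False
    have sub: "pending v a F \<subseteq> F" by (auto simp: pending_def)
    moreover have "F \<subseteq> clauses k n" using Suc.prems by (simp add: waiter_inv_def)
    ultimately have "finite (pending v a F)"
      by (meson finite_clauses finite_subset)
    moreover have "card (pending v a F) \<le> q + 1"
      using card_pending[OF Suc.prems \<open>v < n\<close>] assms(3) by simp
    moreover have "\<exists>w b. waiter_inv k n w b (F - pending v a F) (insert C S)"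
      if "C \<in> pending v a F" for C
      using waiter_inv_claim[OF Suc.prems \<open>v < n\<close> that] by (rule exI)
    ultimately show ?thesis
      using False sub by (intro exI[of _ "pending v a F"] conjI ballI)
  qed
qed

lemma waiter_wins_ksat:
  assumes "k \<ge> 1" "2 * ((n - 1) choose (k - 1)) \<le> q + 1"
  shows "waiter_can_ensure_throughout (clauses k n) q satisfiable"
proof (rule waiter_can_ensure_throughoutI[where Inv = "\<lambda>F S. \<exists>v a. waiter_inv k n v a F S"])
  \<comment> \<open>\<open>k \<ge> 1\<close> excludes the empty clause, the only one that could
    break the invariant at \<open>v = 0\<close>.\<close>
  have "\<not> var ` C \<subseteq> {}" if "C \<in> clauses k n" for C
    using that \<open>k \<ge> 1\<close> by (auto simp: clauses_def)
  then have "waiter_inv k n 0 a (clauses k n) {}" for a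
    by (auto simp: waiter_inv_def)
  then show "\<exists>v a. waiter_inv k n v a (clauses k n) {}" by blast
next
  fix F S
  assume "\<exists>v a. waiter_inv k n v a F S" and ne: "F \<noteq> {}"
  then obtain v a where inv: "waiter_inv k n v a F S" by (elim exE)
  show "\<exists>A\<subseteq>F. A \<noteq> {} \<and> finite A \<and> card A \<le> q + 1 \<and>
      (\<forall>C\<in>A. \<exists>v a. waiter_inv k n v a (F - A) (insert C S))"
    by (rule waiter_inv_step[OF inv ne assms(2)])
next
  fix F S
  assume "\<exists>v a. waiter_inv k n v a F S"
  then obtain v a where "waiter_inv k n v a F S" by (elim exE)
  then have "\<forall>C\<in>S. \<exists>l\<in>C. literal_true a l"
    by (auto simp: waiter_inv_def)
  then show "satisfiable S"
    unfolding satisfiable_def by (rule exI[of _ a])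
qed (rule finite_clauses)

section \<open>The bounds on the bias\<close>

text \<open>Follows from \<open>n choose k \<ge> (n / k) ^ k \<ge> (n / k) ^ 2\<close>. It absorbs
  the gap between \<open>q\<close> and \<open>q + 1\<close> in Client's bound.\<close>

lemma three_mult_le_choose:
  assumes "k \<ge> 2" "n \<ge> 3 * k\<^sup>2"
  shows "3 * real n \<le> real (n choose k)"
proof -
  have "k \<le> k\<^sup>2" by (simp add: power2_eq_square)
  then have "k \<le> n" using assms(2) by linarith
  have "real (3 * k\<^sup>2) \<le> real n" using assms(2) of_nat_le_iff by blast
  then have "real n * (3 * real k ^ 2) \<le> real n * real n"
    by (intro mult_left_mono) auto
  then have "3 * real n \<le> (real n / real k) ^ 2"
    using assms(1) by (simp add: field_simps power2_eq_square)
  also have "\<dots> \<le> (real n / real k) ^ k"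
    using assms(1) \<open>k \<le> n\<close> by (intro power_increasing) auto
  also have "\<dots> \<le> real (n choose k)"
    using binomial_ge_n_over_k_pow_k[OF \<open>k \<le> n\<close>, where 'a = real] by simp
  finally show ?thesis .
qed

lemma ln_2_le: "ln 2 \<le> (3/4 :: real)"
proof -
  \<comment> \<open>Six factors of \<open>exp (1/8)\<close> give \<open>exp (3/4)\<close>, and
    \<open>(9/8) ^ 6\<close> just exceeds 2.\<close>
  have "(2::real) \<le> (1 + 1/8) ^ 6" by (simp add: power_divide)
  also have "\<dots> \<le> exp (1/8) ^ 6"
    by (intro power_mono exp_ge_add_one_self) auto
  also have "\<dots> = exp (3/4)" by (simp flip: exp_of_nat_mult)
  finally have "ln 2 \<le> ln (exp (3/4 :: real))"
    by (subst ln_le_cancel_iff) auto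
  then show ?thesis by simp
qed

theorem theorem1p5:
  fixes k :: nat
  assumes "k \<ge> 2"
  shows "\<exists>n0::nat. \<forall>n\<ge>n0. \<forall>q::nat. q \<ge> 1 \<longrightarrow>
    (real q < real (n choose k) / real n \<longrightarrow>
      client_can_ensure_at_end (clauses k n) q (\<lambda>S. \<not> satisfiable S)) \<and>
    (real q \<ge> 16 * real k ^ 3 * real (n choose k) / real n \<longrightarrow>
      waiter_can_ensure_throughout (clauses k n) q satisfiable)"
proof (intro exI[of _ "3 * k\<^sup>2"] allI impI conjI)
  fix n q :: nat
  assume n: "3 * k\<^sup>2 \<le> n" and q: "real q < real (n choose k) / real n"
  have "n > 0" using n assms by (auto intro: Nat.gr0I)
  let ?c = "real (n choose k)"
  from q \<open>n > 0\<close> have "real n * real q < ?c" by (simp add: field_simps)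
  moreover have "3 * real n \<le> ?c" by (rule three_mult_le_choose[OF assms n])
  \<comment> \<open>The term with \<open>q\<close> costs less than \<open>3/4\<close> of
    \<open>?c\<close>, the remaining \<open>3/4 * n\<close> at most \<open>1/4\<close> of
    it.\<close>
  ultimately have "real n * (3/4) * (real q + 1) < ?c"
    by (simp add: algebra_simps)
  then have "real n * (3/4) < ?c / (real q + 1)"
    by (simp add: field_simps)
  moreover have "real n * ln 2 \<le> real n * (3/4)"
    using ln_2_le by (intro mult_left_mono) auto
  ultimately have "real n * ln 2 < ?c / (real q + 1)" by linarith
  then have "exp (real n * ln 2 + - ?c / (real q + 1)) < 1" by simp
  moreover have "exp (real n * ln 2) = (2::real) ^ n"
    by (simp add: exp_of_nat_mult)
  ultimately have "2 ^ n * exp (- ?c / (real q + 1)) < 1"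
    by (simp only: exp_add)
  then show "client_can_ensure_at_end (clauses k n) q (\<lambda>S. \<not> satisfiable S)"
    by (rule client_wins_ksat)
next
  fix n q :: nat
  assume n: "3 * k\<^sup>2 \<le> n" and q: "16 * real k ^ 3 * real (n choose k) / real n \<le> real q"
  have "n > 0" using n assms by (auto intro: Nat.gr0I)
  \<comment> \<open>Absorption rewrites the bound on the size of Waiter's offers in terms of
    \<open>n choose k\<close>.\<close>
  have "k * (n choose k) = n * ((n - 1) choose (k - 1))"
    using assms by (intro times_binomial_minus1_eq) simp
  then have "real k * real (n choose k) = real n * real ((n - 1) choose (k - 1))"
    by (metis of_nat_mult)
  then have "2 * real ((n - 1) choose (k - 1)) = 2 * real k * real (n choose k) / real n"
    using \<open>n > 0\<close> by (simp add: field_simps)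
  also have "\<dots> \<le> 16 * real k ^ 3 * real (n choose k) / real n"
  proof (intro divide_right_mono mult_right_mono mult_mono)
    show "real k \<le> real k ^ 3" using assms by (intro self_le_power) auto
  qed auto
  also have "\<dots> \<le> real q" by (rule q)
  finally have "2 * ((n - 1) choose (k - 1)) \<le> q" by linarith
  then show "waiter_can_ensure_throughout (clauses k n) q satisfiable"
    using assms by (intro waiter_wins_ksat) auto
qed

end
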